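(* Let $F:\mathbb{R}^{n+m}\to\mathbb{R}\cup\{+\infty\}$ be closed proper convex, and let $\varphi^*$ be the convex conjugate of $\varphi(u)=\inf_{x\in\mathbb{R}^n}F(x,u)$, $u\in\mathbb{R}^m$. Let $p^0\in\mathbb{R}^m$ be arbitrary, and suppose that: (i) $\{c_k\}_{k=0}^\infty$ is a sequence of positive scalars with $\inf_{k\ge0}c_k>0$; (ii) $\{\nu_k\}_{k=0}^\infty$ is a sequence of real numbers with $\inf_{k\ge0}\nu_k>0$ and $\sup_{k\ge0}\nu_k<2$; (iii) $\{\delta_k\}_{k=0}^\infty$ is a sequence of nonnegative numbers with $\sum_{k=0}^\infty\sqrt{c_k\delta_k}<\infty$; (iv) $W$ is a symmetric positive definite $m\times m$ matrix. Suppose that the sequences $\{p^k\}_{k=0}^\infty,\{u^k\}_{k=1}^\infty\subset\mathbb{R}^m$ and $\{x^k\}_{k=1}^\infty\subset\mathbb{R}^n$ satisfy, for all $k\ge0$, $$(x^{k+1},u^{k+1})\in \delta_k\text{-}\!\operatorname*{arg\,min}_{x\in\mathbb{R}^n,\,u\in\mathbb{R}^m}\Big\{F(x,u)-\langle p^k,u\rangle+\frac{c_k}{2}\|u\|_W^2\Big\},$$ $$p^{k+1}=p^k-\nu_kc_kWu^{k+1},$$ where, for every $k$, the exact minimum of the minimand is assumed to be attained. If the dual problem of minimizing $\varphi^*$ over $\mathbb{R}^m$ has an optimal solution, then $\{p^k\}$ converges to some minimizer of $\varphi^*$, and furthermore $$\lim_{k\to\infty}c_ku^{k+1}=0,\qquad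 \lim_{k\to\infty}u^k=0,\qquad \limsup_{k\to\infty}F(x^k,u^k)\le\inf\{F(x,0)\mid x\in\mathbb{R}^n\},$$ and every limit point of the sequence $\{x^k\}$ is an optimal solution of the primal problem $\min_{x\in\mathbb{R}^n}F(x,0)$. If $\varphi^*$ has no minimizer, then $\{p^k\}$ is an unbounded sequence.
   Context: For a symmetric positive definite matrix $W$, $\|u\|_W=\sqrt{u^\top Wu}$. For $\delta\ge0$, a set $S$ and a function $h:S\to\mathbb{R}\cup\{\pm\infty\}$, $$\delta\text{-}\!\operatorname*{arg\,min}_{x\in S}\{h(x)\}=\Big\{x\in S\ \Big|\ h(x)\le\big(\inf_{y\in S}h(y)\big)+\delta\Big\}.$$ The convex conjugate is $\varphi^*(p)=\sup_{u\in\mathbb{R}^m}\{\langle u,p\rangle-\varphi(u)\}$; one has $\varphi^*(p)=F^*(0,p)$. "Closed" means lower semicontinuous. *)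

theory Defs
  imports "HOL-Analysis.Analysis"
begin

text \<open>Extended-real-valued convex functions. The values of interest lie in
  \<open>\<real> \<union> {+\<infinity>}\<close>; this is part of properness. Convexity is convexity of the epigraph,
  a subset of \<open>'a \<times> \<real>\<close>.\<close>

definition ereal_convex :: "('a::real_vector \<Rightarrow> ereal) \<Rightarrow> bool" where
  "ereal_convex f \<longleftrightarrow> convex {(z, t::real). f z \<le> ereal t}"

definition proper :: "('a \<Rightarrow> ereal) \<Rightarrow> bool" where
  "proper f \<longleftrightarrow> (\<forall>z. f z \<noteq> -\<infinity>) \<and> (\<exists>z. f z \<noteq> \<infinity>)"

definition lower_semicontinuous :: "('a::topological_space \<Rightarrow> ereal) \<Rightarrow> bool" where
  "lower_semicontinuous f \<longleftrightarrow> (\<forall>z. f z \<le> Liminf (at z) f)"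

definition conjugate :: "('a::real_inner \<Rightarrow> ereal) \<Rightarrow> 'a \<Rightarrow> ereal" where
  "conjugate f p = (SUP u. ereal (u \<bullet> p) - f u)"

definition delta_argmin :: "real \<Rightarrow> 'a set \<Rightarrow> ('a \<Rightarrow> ereal) \<Rightarrow> 'a set" where
  "delta_argmin \<delta> S h = {x \<in> S. h x \<le> (INF y\<in>S. h y) + ereal \<delta>}"

text \<open>Minimizers over the whole space. A minimizer is required to be feasible, i.e. to have
  value \<open>< \<infinity>\<close>, so the function that is constantly \<open>\<infinity>\<close> has none.\<close>

definition is_minimizer :: "('a \<Rightarrow> ereal) \<Rightarrow> 'a \<Rightarrow> bool" where
  "is_minimizer h x \<longleftrightarrow> h x < \<infinity> \<and> (\<forall>y. h x \<le> h y)"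

definition sym_pos_def :: "real^'m^'m \<Rightarrow> bool" where
  "sym_pos_def W \<longleftrightarrow> transpose W = W \<and> (\<forall>u. u \<noteq> 0 \<longrightarrow> 0 < u \<bullet> (W *v u))"

definition wnorm :: "real^'m^'m \<Rightarrow> real^'m \<Rightarrow> real" where
  "wnorm W u = sqrt (u \<bullet> (W *v u))"

definition value_fun :: "('a \<times> 'b \<Rightarrow> ereal) \<Rightarrow> 'b \<Rightarrow> ereal" where
  "value_fun F u = (INF x. F (x, u))"

definition aug_lagrangian ::
    "((real^'n) \<times> (real^'m) \<Rightarrow> ereal) \<Rightarrow> real^'m^'m \<Rightarrow> real \<Rightarrow> real^'m \<Rightarrow> (real^'n) \<times> (real^'m) \<Rightarrow> ereal"
  where
  "aug_lagrangian F W c p =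
     (\<lambda>(x, u). F (x, u) - ereal (p \<bullet> u) + ereal (c / 2 * (wnorm W u)\<^sup>2))"

text \<open>Limit points of a sequence are the limits of its convergent subsequences.\<close>

definition seq_limit_point :: "(nat \<Rightarrow> 'a::topological_space) \<Rightarrow> 'a \<Rightarrow> bool" where
  "seq_limit_point x z \<longleftrightarrow> (\<exists>r::nat \<Rightarrow> nat. strict_mono r \<and> (x \<circ> r) \<longlonglongrightarrow> z)"

end

theory Submission
  imports Defs
begin

text \<open>An exact minimizer \<open>(xh k, uh k)\<close> of the augmented Lagrangian yields
  \<open>ph k = p k - c k W (uh k)\<close> with \<open>(0, ph k)\<close> a subgradient of \<open>F\<close> at \<open>(xh k, uh k)\<close>. Hence
  \<open>uh k\<close> is a subgradient of the conjugate \<open>\<phi>\<^sup>*\<close> at \<open>ph k\<close>, i.e. \<open>ph k\<close> is the proximal point of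
  \<open>\<phi>\<^sup>*\<close> from \<open>p k\<close> in the metric of \<open>W\<inverse>\<close>. Strong convexity in \<open>u\<close> bounds the multiplier error
  of a \<open>\<delta> k\<close>-minimizer by a multiple of \<open>sqrt (c k * \<delta> k)\<close>, which is summable, so the over- or
  underrelaxed iteration is quasi-Fejer monotone with respect to the dual solutions.\<close>

section \<open>The norm of a positive definite matrix\<close>

lemma inner_matrix_commute:
  assumes "sym_pos_def W"
  shows "(W *v a) \<bullet> b = a \<bullet> (W *v b)"
  using assms by (metis dot_lmul_matrix sym_pos_def_def transpose_matrix_vector)

lemma inner_matrix_nonneg: "sym_pos_def W \<Longrightarrow> 0 \<le> a \<bullet> (W *v a)"
  by (cases "a = 0") (auto simp: sym_pos_def_def intro: less_imp_le)

lemma wnorm_square: "sym_pos_def W \<Longrightarrow> (wnorm W a)\<^sup>2 = a \<bullet> (W *v a)"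
  by (simp add: wnorm_def inner_matrix_nonneg)

lemma wnorm_nonneg: "sym_pos_def W \<Longrightarrow> 0 \<le> wnorm W a"
  by (simp add: wnorm_def inner_matrix_nonneg)

lemma wnorm_scaleR: "wnorm W (t *\<^sub>R a) = \<bar>t\<bar> * wnorm W a"
  by (simp add: wnorm_def matrix_vector_mult_scaleR mult.assoc[symmetric] real_sqrt_mult
      real_sqrt_abs2)

lemma wnorm_add_square:
  assumes "sym_pos_def W"
  shows "(wnorm W (a + b))\<^sup>2 = (wnorm W a)\<^sup>2 + 2 * (a \<bullet> (W *v b)) + (wnorm W b)\<^sup>2"
  using inner_matrix_commute[OF assms, of b a]
  by (simp add: wnorm_square[OF assms] matrix_vector_right_distrib inner_add_left
      inner_add_right inner_commute)

lemma wnorm_diff_square: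
  assumes "sym_pos_def W"
  shows "(wnorm W (a - b))\<^sup>2 = (wnorm W a)\<^sup>2 - 2 * (a \<bullet> (W *v b)) + (wnorm W b)\<^sup>2"
  using inner_matrix_commute[OF assms, of b a]
  by (simp add: wnorm_square[OF assms] matrix_vector_mult_diff_distrib inner_diff_left
      inner_diff_right inner_commute)

text \<open>Weighting each vector by the norm of the other makes the expanded square factor into a
  positive multiple of the gap in the inequality, for nonzero vectors.\<close>

lemma wnorm_Cauchy_Schwarz:
  assumes W: "sym_pos_def W"
  shows "a \<bullet> (W *v b) \<le> wnorm W a * wnorm W b"
proof (cases "a = 0 \<or> b = 0")
  case True
  then show ?thesis by (auto simp: wnorm_def)
next
  case False
  then have pos: "0 < wnorm W a" "0 < wnorm W b"
    using W by (auto simp: wnorm_def sym_pos_def_def)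
  have "0 \<le> (wnorm W (wnorm W b *\<^sub>R a - wnorm W a *\<^sub>R b))\<^sup>2"
    by simp
  also have "\<dots> = 2 * (wnorm W a * wnorm W b) * (wnorm W a * wnorm W b - a \<bullet> (W *v b))"
    unfolding wnorm_diff_square[OF W] wnorm_scaleR
    by (simp add: matrix_vector_mult_scaleR power2_eq_square algebra_simps)
  finally show ?thesis
    using mult_pos_pos[OF pos] by (auto simp: zero_le_mult_iff)
qed

lemma wnorm_triangle:
  assumes W: "sym_pos_def W"
  shows "wnorm W (a + b) \<le> wnorm W a + wnorm W b"
proof (rule power2_le_imp_le)
  show "(wnorm W (a + b))\<^sup>2 \<le> (wnorm W a + wnorm W b)\<^sup>2"
    using wnorm_Cauchy_Schwarz[OF W, of a b] by (simp add: wnorm_add_square[OF W] power2_sum)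
qed (simp add: wnorm_nonneg[OF W])

lemma wnorm_minus: "wnorm W (- a) = wnorm W a"
  using wnorm_scaleR[of W "-1" a] by simp

lemma continuous_on_wnorm: "continuous_on UNIV (wnorm W)"
  unfolding wnorm_def by (intro continuous_intros matrix_vector_mult_linear_continuous_on)

text \<open>Compactness of the Euclidean unit sphere gives the W-norm a positive minimum there, and
  homogeneity extends the bound. Limits and bounds can thus be moved between the two norms.\<close>

lemma wnorm_lower_bound:
  fixes W :: "real^'m^'m"
  assumes W: "sym_pos_def W"
  obtains m where "0 < m" "\<And>a. m * norm a \<le> wnorm W a"
proof -
  obtain s where s: "s \<in> sphere (0::real^'m) 1" "\<And>a. a \<in> sphere 0 1 \<Longrightarrow> wnorm W s \<le> wnorm W a"
    using continuous_attains_inf[of "sphere (0::real^'m) 1" "wnorm W"]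
      continuous_on_subset[OF continuous_on_wnorm] by (metis compact_sphere sphere_eq_empty
        not_less subset_UNIV zero_le_one)
  have "s \<noteq> 0" using s by auto
  then have "0 < wnorm W s" using W by (simp add: wnorm_def sym_pos_def_def)
  moreover have "wnorm W s * norm a \<le> wnorm W a" for a
  proof (cases "a = 0")
    case False
    have "wnorm W s * norm a \<le> wnorm W ((1 / norm a) *\<^sub>R a) * norm a"
      using False by (intro mult_right_mono s) auto
    then show ?thesis using False by (simp add: wnorm_scaleR)
  qed (simp add: wnorm_def)
  ultimately show ?thesis using that by blast
qed

lemma tendsto_zero_wnorm_iff:
  assumes W: "sym_pos_def W"
  shows "((\<lambda>k. wnorm W (f k)) \<longlongrightarrow> 0) G \<longleftrightarrow> (f \<longlongrightarrow> 0) G"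
proof
  assume *: "((\<lambda>k. wnorm W (f k)) \<longlongrightarrow> 0) G"
  obtain m where m: "0 < m" "\<And>a. m * norm a \<le> wnorm W a"
    using wnorm_lower_bound[OF W] by blast
  have "((\<lambda>k. wnorm W (f k) / m) \<longlongrightarrow> 0) G"
    using tendsto_divide[OF * tendsto_const[of m]] m by simp
  then show "(f \<longlongrightarrow> 0) G"
    by (rule Lim_null_comparison[rotated]) (use m in \<open>simp add: field_simps\<close>)
next
  assume "(f \<longlongrightarrow> 0) G"
  then have "((\<lambda>k. wnorm W (f k)) \<longlongrightarrow> wnorm W 0) G"
    using continuous_on_tendsto_compose[OF continuous_on_wnorm, of f 0 G W] by simp
  then show "((\<lambda>k. wnorm W (f k)) \<longlongrightarrow> 0) G" by (simp add: wnorm_def)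
qed

lemma bounded_range_wnorm_iff:
  fixes f :: "'i \<Rightarrow> real^'m"
  assumes W: "sym_pos_def W"
  shows "bounded (range f) \<longleftrightarrow> (\<exists>B. \<forall>k. wnorm W (f k) \<le> B)"
proof
  assume "bounded (range f)"
  then have "compact (closure (range f))" by simp
  then have "bounded (wnorm W ` closure (range f))"
    by (intro compact_imp_bounded compact_continuous_image
        continuous_on_subset[OF continuous_on_wnorm]) auto
  then obtain B where B: "\<And>y. y \<in> wnorm W ` closure (range f) \<Longrightarrow> \<bar>y\<bar> \<le> B"
    unfolding bounded_iff real_norm_def by blast
  have "f k \<in> closure (range f)" for k
    by (rule subsetD[OF closure_subset]) simp
  then have "wnorm W (f k) \<le> B" for k
    by (rule abs_le_D1[OF B[OF imageI]])
  then show "\<exists>B. \<forall>k. wnorm W (f k) \<le> B" by blast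
next
  assume "\<exists>B. \<forall>k. wnorm W (f k) \<le> B"
  then obtain B where B: "\<And>k. wnorm W (f k) \<le> B" by blast
  obtain m where m: "0 < m" "\<And>a. m * norm a \<le> wnorm W a"
    using wnorm_lower_bound[OF W] by blast
  have "norm (f k) \<le> B / m" for k
    using order_trans[OF m(2) B, of k] m(1) by (simp add: field_simps)
  then show "bounded (range f)" by (auto simp: bounded_iff)
qed

section \<open>Duality between the metric of \<open>W\<close> and that of its inverse\<close>

lemma sym_pos_def_mult_inverse:
  assumes W: "sym_pos_def W"
  shows "matrix_inv W *v (W *v a) = a" "W *v (matrix_inv W *v a) = a"
proof -
  have "W *v a = 0 \<Longrightarrow> a = 0" for a
    using W by (force simp: sym_pos_def_def)
  then have "invertible W"
    by (simp add: invertible_left_inverse matrix_left_invertible_ker)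
  then have "W ** matrix_inv W = mat 1 \<and> matrix_inv W ** W = mat 1"
    unfolding invertible_def matrix_inv_def by (rule someI_ex)
  then show "matrix_inv W *v (W *v a) = a" "W *v (matrix_inv W *v a) = a"
    by (simp_all add: matrix_vector_mul_assoc)
qed

text \<open>Every vector is the image under \<open>W\<close> of its preimage, so the quadratic form
  of the inverse is the form of \<open>W\<close> evaluated at that preimage.\<close>

lemma sym_pos_def_matrix_inv:
  fixes W :: "real^'m^'m"
  assumes W: "sym_pos_def W"
  shows "sym_pos_def (matrix_inv W)"
proof -
  let ?V = "matrix_inv W"
  note inv = sym_pos_def_mult_inverse[OF W]
  have sym: "(?V *v a) \<bullet> b = a \<bullet> (?V *v b)" for a b
    using inner_matrix_commute[OF W, of "?V *v a" "?V *v b"] by (simp add: inv)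
  have "transpose ?V = ?V"
  proof (rule matrix_eq[THEN iffD2, rule_format])
    fix b
    have "(transpose ?V *v b) \<bullet> a = (?V *v b) \<bullet> a" for a
      using sym[of b a] by (metis dot_lmul_matrix transpose_matrix_vector)
    then show "transpose ?V *v b = ?V *v b"
      by (metis vector_eq_rdot)
  qed
  moreover have "0 < a \<bullet> (?V *v a)" if "a \<noteq> 0" for a
  proof -
    have "?V *v a \<noteq> 0" using inv(2)[of a] that by force
    then have "0 < (?V *v a) \<bullet> (W *v (?V *v a))"
      using W by (simp add: sym_pos_def_def)
    then show ?thesis by (simp add: inv inner_commute)
  qed
  ultimately show ?thesis by (simp add: sym_pos_def_def)
qed

lemma wnorm_matrix_inv_mult:
  assumes "sym_pos_def W"
  shows "wnorm (matrix_inv W) (W *v a) = wnorm W a"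
  by (simp add: wnorm_def sym_pos_def_mult_inverse[OF assms] inner_commute)

section \<open>The inexact relaxed proximal point method\<close>

text \<open>Subtracting the partial sums of the errors leaves a decreasing sequence bounded below by
  minus the total error.\<close>

lemma quasi_monotone_convergent:
  fixes a \<epsilon> :: "nat \<Rightarrow> real"
  assumes step: "\<And>k. a (Suc k) \<le> a k + \<epsilon> k"
    and nonneg: "\<And>k. 0 \<le> a k" "\<And>k. 0 \<le> \<epsilon> k" and summable: "summable \<epsilon>"
  shows "convergent a"
proof -
  define b where "b k = a k - (\<Sum>i<k. \<epsilon> i)" for k
  have "decseq b"
    using step by (intro decseq_SucI) (simp add: b_def algebra_simps)
  moreover have "- suminf \<epsilon> \<le> b k" for k
    using sum_le_suminf[OF summable, of "{..<k}"] nonneg(1)[of k] nonneg(2)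
    by (simp add: b_def)
  ultimately obtain l where "b \<longlonglongrightarrow> l"
    using decseq_convergent by metis
  then have "(\<lambda>k. b k + (\<Sum>i<k. \<epsilon> i)) \<longlonglongrightarrow> l + suminf \<epsilon>"
    by (intro tendsto_add summable_LIMSEQ summable)
  then show ?thesis by (auto simp: b_def convergent_def)
qed

text \<open>The points \<open>ph k\<close> are the exact proximal points of \<open>g\<close> from \<open>p k\<close> in the metric of
  \<open>W\<inverse>\<close>, with subgradients \<open>vh k\<close>; the iteration uses approximate subgradients \<open>v k\<close>.\<close>

locale relaxed_proximal_point =
  fixes g :: "real^'m \<Rightarrow> ereal" and W :: "real^'m^'m"
    and c \<nu> \<eta> \<gamma> :: "nat \<Rightarrow> real" and p ph v vh :: "nat \<Rightarrow> real^'m"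
    and cmin \<nu>min \<nu>max :: real
  assumes closed_sublevel: "\<And>t. closed {q. g q \<le> ereal t}"
    and W: "sym_pos_def W"
    and cmin: "0 < cmin" "\<And>k. cmin \<le> c k"
    and \<nu>min: "0 < \<nu>min" "\<And>k. \<nu>min \<le> \<nu> k"
    and \<nu>max: "\<nu>max < 2" "\<And>k. \<nu> k \<le> \<nu>max"
    and attained: "\<And>k. g (ph k) = ereal (\<gamma> k)"
    and subgradient: "\<And>k q. ereal (\<gamma> k + (q - ph k) \<bullet> vh k) \<le> g q"
    and ph: "\<And>k. ph k = p k - c k *\<^sub>R (W *v vh k)"
    and step: "\<And>k. p (Suc k) = p k - (\<nu> k * c k) *\<^sub>R (W *v v k)"
    and error: "\<And>k. c k * wnorm W (v k - vh k) \<le> \<eta> k"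
    and summable_error: "summable \<eta>"
begin

text \<open>This metric suits the multipliers: in it \<open>W *v a\<close> has length
  \<open>wnorm W a\<close>, and its inner product with \<open>b\<close> is the Euclidean
  \<open>a \<bullet> b\<close>.\<close>

definition dnorm :: "real^'m \<Rightarrow> real" where "dnorm = wnorm (matrix_inv W)"

lemma inverse_spd: "sym_pos_def (matrix_inv W)"
  by (rule sym_pos_def_matrix_inv[OF W])

lemma c_pos: "0 < c k"
  using cmin(1) cmin(2)[of k] by linarith

lemma \<nu>_pos: "0 < \<nu> k"
  using \<nu>min(1) \<nu>min(2)[of k] by linarith

lemma \<nu>_less: "\<nu> k < 2"
  using \<nu>max(1) \<nu>max(2)[of k] by linarith

lemma error_nonneg: "0 \<le> \<eta> k"
  using error[of k] c_pos[of k] wnorm_nonneg[OF W, of "v k - vh k"]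
  by (meson mult_nonneg_nonneg less_imp_le order_trans)

lemma error_tendsto: "(\<lambda>k. c k *\<^sub>R (v k - vh k)) \<longlonglongrightarrow> 0"
proof -
  have "(\<lambda>k. wnorm W (c k *\<^sub>R (v k - vh k))) \<longlonglongrightarrow> 0"
  proof (rule tendsto_sandwich[OF _ _ tendsto_const summable_LIMSEQ_zero[OF summable_error]])
    show "\<forall>\<^sub>F k in sequentially. wnorm W (c k *\<^sub>R (v k - vh k)) \<le> \<eta> k"
      using error c_pos by (simp add: wnorm_scaleR less_imp_le)
  qed (simp add: wnorm_nonneg[OF W])
  then show ?thesis by (simp add: tendsto_zero_wnorm_iff[OF W])
qed

text \<open>The subgradient inequality bounds \<open>(p k - q) \<bullet> vh k\<close> below by
  \<open>c k\<close> times the squared W-norm of \<open>vh k\<close>; in the expanded square this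
  leaves the factor \<open>2 * \<nu> k - (\<nu> k)\<^sup>2\<close>. Since \<open>q\<close> is only
  compared with \<open>ph k\<close>, it may be a surrogate for a minimizer.\<close>

lemma exact_step_decrease:
  assumes "g q \<le> g (ph k)"
  shows "(dnorm (p k - (\<nu> k * c k) *\<^sub>R (W *v vh k) - q))\<^sup>2
      \<le> (dnorm (p k - q))\<^sup>2 - \<nu> k * (2 - \<nu> k) * (wnorm W (c k *\<^sub>R vh k))\<^sup>2"
proof -
  have "ereal (\<gamma> k + (q - ph k) \<bullet> vh k) \<le> ereal (\<gamma> k)"
    using subgradient[of k q] assms attained[of k] by (metis order_trans)
  then have "(q - ph k) \<bullet> vh k \<le> 0" by simp
  then have "c k * (wnorm W (vh k))\<^sup>2 \<le> (p k - q) \<bullet> vh k"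
    by (simp add: ph wnorm_square[OF W] inner_diff_left inner_diff_right
        inner_commute[of _ "vh k"])
  then have "2 * \<nu> k * c k * (c k * (wnorm W (vh k))\<^sup>2) \<le> 2 * \<nu> k * c k * ((p k - q) \<bullet> vh k)"
    using c_pos[of k] \<nu>_pos[of k] by (intro mult_left_mono) auto
  moreover have "(dnorm (p k - q - W *v ((\<nu> k * c k) *\<^sub>R vh k)))\<^sup>2
     = (dnorm (p k - q))\<^sup>2 - 2 * (\<nu> k * c k) * ((p k - q) \<bullet> vh k) + (\<nu> k * c k)\<^sup>2 * (wnorm W (vh k))\<^sup>2"
    unfolding dnorm_def wnorm_diff_square[OF inverse_spd] wnorm_matrix_inv_mult[OF W]
    by (simp add: sym_pos_def_mult_inverse[OF W] wnorm_scaleR power_mult_distrib)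
  moreover have "(dnorm (p k - (\<nu> k * c k) *\<^sub>R (W *v vh k) - q))\<^sup>2
      = (dnorm (p k - q - W *v ((\<nu> k * c k) *\<^sub>R vh k)))\<^sup>2"
    by (simp add: matrix_vector_mult_scaleR algebra_simps)
  moreover have "\<nu> k * (2 - \<nu> k) * (wnorm W (c k *\<^sub>R vh k))\<^sup>2
      = 2 * \<nu> k * c k * (c k * (wnorm W (vh k))\<^sup>2) - (\<nu> k * c k)\<^sup>2 * (wnorm W (vh k))\<^sup>2"
    by (simp add: wnorm_scaleR power_mult_distrib) (simp add: algebra_simps power2_eq_square)
  ultimately show ?thesis by linarith
qed

lemma distance_to_exact_step:
  "dnorm (p (Suc k) - (p k - (\<nu> k * c k) *\<^sub>R (W *v vh k))) \<le> 2 * \<eta> k"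
proof -
  have "p (Suc k) - (p k - (\<nu> k * c k) *\<^sub>R (W *v vh k)) = - (W *v ((\<nu> k * c k) *\<^sub>R (v k - vh k)))"
    by (simp add: step matrix_vector_mult_scaleR matrix_vector_mult_diff_distrib scaleR_diff_right)
  then have "dnorm (p (Suc k) - (p k - (\<nu> k * c k) *\<^sub>R (W *v vh k)))
      = \<nu> k * (c k * wnorm W (v k - vh k))"
    using \<nu>_pos[of k] c_pos[of k]
    by (simp add: dnorm_def wnorm_minus wnorm_matrix_inv_mult[OF W] wnorm_scaleR)
  also have "\<dots> \<le> 2 * \<eta> k"
    using \<nu>_pos[of k] \<nu>_less[of k] error[of k] error_nonneg[of k] c_pos[of k]
      wnorm_nonneg[OF W, of "v k - vh k"] by (intro mult_mono) auto
  finally show ?thesis .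
qed

text \<open>Exact steps do not increase the distance to \<open>q\<close>, and actual steps deviate
  from them by a summable amount. The distances therefore converge, which forces the decrease term
  to vanish.\<close>

lemma quasi_Fejer:
  assumes q: "\<And>k. g q \<le> g (ph k)"
  shows "convergent (\<lambda>k. dnorm (p k - q))" and "(\<lambda>k. c k *\<^sub>R vh k) \<longlonglongrightarrow> 0"
proof -
  define a where "a k = dnorm (p k - q)" for k
  define b where "b k = dnorm (p k - (\<nu> k * c k) *\<^sub>R (W *v vh k) - q)" for k
  define s where "s k = (wnorm W (c k *\<^sub>R vh k))\<^sup>2" for k
  have a0: "0 \<le> a k" and b0: "0 \<le> b k" for k
    by (simp_all add: a_def b_def dnorm_def wnorm_nonneg[OF inverse_spd])
  have dec: "(b k)\<^sup>2 \<le> (a k)\<^sup>2 - \<nu> k * (2 - \<nu> k) * s k" for k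
    using exact_step_decrease[OF q] by (simp add: a_def b_def s_def)
  \<comment> \<open>Relaxation bounded away from both 0 and 2 makes the decrease factor uniform in
    \<open>k\<close>.\<close>
  have coef: "\<nu>min * (2 - \<nu>max) \<le> \<nu> k * (2 - \<nu> k)" for k
    using \<nu>min \<nu>max(1) \<nu>max(2)[of k] \<nu>_pos[of k] \<nu>_less[of k] by (intro mult_mono) auto
  have s0: "0 \<le> s k" for k by (simp add: s_def)
  have "0 \<le> \<nu> k * (2 - \<nu> k) * s k" for k
    using \<nu>_pos[of k] \<nu>_less[of k] s0[of k] by simp
  then have ba: "b k \<le> a k" for k
    using dec[of k] a0[of k] by (intro power2_le_imp_le[of "b k" "a k"]) (smt (verit), simp)
  have "a (Suc k) \<le> dnorm (p (Suc k) - (p k - (\<nu> k * c k) *\<^sub>R (W *v vh k))) + b k" for k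
    using wnorm_triangle[OF inverse_spd, of "p (Suc k) - (p k - (\<nu> k * c k) *\<^sub>R (W *v vh k))"
        "p k - (\<nu> k * c k) *\<^sub>R (W *v vh k) - q"] by (simp add: a_def b_def dnorm_def)
  then have ab: "a (Suc k) \<le> 2 * \<eta> k + b k" for k
    using distance_to_exact_step[of k] by (smt (verit))
  have "a (Suc k) \<le> a k + 2 * \<eta> k" for k
    using ab[of k] ba[of k] by linarith
  then have conv: "convergent a"
    by (rule quasi_monotone_convergent) (auto simp: a0 error_nonneg summable_error)
  then show "convergent (\<lambda>k. dnorm (p k - q))" by (simp add: a_def[abs_def])
  from conv obtain l where l: "a \<longlonglongrightarrow> l" by (auto simp: convergent_def)
  have "(\<lambda>k. a (Suc k) - 2 * \<eta> k) \<longlonglongrightarrow> l - 2 * 0"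
    by (intro tendsto_intros LIMSEQ_Suc[OF l] summable_LIMSEQ_zero[OF summable_error])
  then have lower: "(\<lambda>k. a (Suc k) - 2 * \<eta> k) \<longlonglongrightarrow> l" by simp
  \<comment> \<open>Here \<open>b k\<close> lies between \<open>a (Suc k) - 2 * \<eta> k\<close> and
    \<open>a k\<close>, so the gap between the squares, which dominates \<open>s k\<close>, tends to
    0.\<close>
  have bl: "b \<longlonglongrightarrow> l"
    by (rule tendsto_sandwich[OF _ _ lower l]) (use ab ba in \<open>simp_all add: algebra_simps\<close>)
  have "(\<lambda>k. ((a k)\<^sup>2 - (b k)\<^sup>2) / (\<nu>min * (2 - \<nu>max))) \<longlonglongrightarrow> (l\<^sup>2 - l\<^sup>2) / (\<nu>min * (2 - \<nu>max))"
    using \<nu>min \<nu>max by (intro tendsto_intros l bl) auto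
  then have upper: "(\<lambda>k. ((a k)\<^sup>2 - (b k)\<^sup>2) / (\<nu>min * (2 - \<nu>max))) \<longlonglongrightarrow> 0" by simp
  have "\<nu>min * (2 - \<nu>max) * s k \<le> (a k)\<^sup>2 - (b k)\<^sup>2" for k
    using dec[of k] mult_right_mono[OF coef[of k] s0[of k]] by linarith
  then have "s k \<le> ((a k)\<^sup>2 - (b k)\<^sup>2) / (\<nu>min * (2 - \<nu>max))" for k
    using \<nu>min \<nu>max by (simp add: pos_le_divide_eq mult.commute)
  then have "s \<longlonglongrightarrow> 0"
    by (intro tendsto_sandwich[OF _ _ tendsto_const upper]) (auto simp: s0)
  then have "(\<lambda>k. sqrt (s k)) \<longlonglongrightarrow> sqrt 0" by (intro tendsto_intros)
  then have "(\<lambda>k. wnorm W (c k *\<^sub>R vh k)) \<longlonglongrightarrow> 0"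
    by (simp add: s_def wnorm_nonneg[OF W])
  then show "(\<lambda>k. c k *\<^sub>R vh k) \<longlonglongrightarrow> 0" by (simp add: tendsto_zero_wnorm_iff[OF W])
qed

lemma tendsto_zero_unscaled:
  assumes "(\<lambda>k. c k *\<^sub>R (w k :: real^'m)) \<longlonglongrightarrow> 0"
  shows "w \<longlonglongrightarrow> 0"
proof -
  have "(\<lambda>k. norm (c k *\<^sub>R w k) / cmin) \<longlonglongrightarrow> 0 / cmin"
    using cmin(1) assms by (intro tendsto_intros tendsto_norm_zero) auto
  moreover have "norm (w k) \<le> norm (c k *\<^sub>R w k) / cmin" for k
    using cmin(1) cmin(2)[of k] c_pos[of k] mult_right_mono[OF cmin(2)[of k] norm_ge_zero[of "w k"]]
    by (simp add: pos_le_divide_eq mult.commute)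
  ultimately show ?thesis
    by (intro Lim_null_comparison[of w]) auto
qed

text \<open>Along the subsequence \<open>ph\<close> has the same limit as \<open>p\<close>, while
  the subgradients tend to 0. The subgradient inequality then loses its linear term in the limit,
  and closed sublevel sets carry the comparison over to \<open>q\<close>.\<close>

lemma cluster_point_minimizes:
  assumes vh: "(\<lambda>k. c k *\<^sub>R vh k) \<longlonglongrightarrow> 0" and r: "strict_mono r" and pr: "(p \<circ> r) \<longlonglongrightarrow> q"
  shows "is_minimizer g q"
proof -
  have W0: "(\<lambda>k. W *v (c k *\<^sub>R vh k)) \<longlonglongrightarrow> W *v 0"
    using vh by (intro continuous_on_tendsto_compose[OF
          matrix_vector_mult_linear_continuous_on[of UNIV W]]) auto
  have "(\<lambda>k. p (r k) - W *v (c (r k) *\<^sub>R vh (r k))) \<longlonglongrightarrow> q - W *v 0"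
    using pr LIMSEQ_subseq_LIMSEQ[OF W0 r] by (intro tendsto_diff) (auto simp: o_def)
  then have phr: "(\<lambda>k. ph (r k)) \<longlonglongrightarrow> q"
    by (simp add: ph matrix_vector_mult_scaleR)
  have vhr: "(\<lambda>k. vh (r k)) \<longlonglongrightarrow> 0"
    using LIMSEQ_subseq_LIMSEQ[OF tendsto_zero_unscaled[OF vh] r] by (simp add: o_def)
  have le: "g q \<le> ereal t" if y: "g y < ereal t" for y t
  proof -
    have "(\<lambda>k. (y - ph (r k)) \<bullet> vh (r k)) \<longlonglongrightarrow> (y - q) \<bullet> 0"
      by (intro tendsto_intros phr vhr)
    then have lim0: "(\<lambda>k. (y - ph (r k)) \<bullet> vh (r k)) \<longlonglongrightarrow> 0" by simp
    \<comment> \<open>The slack \<open>t - s\<close> absorbs the vanishing linear term, so only real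
      thresholds have to be compared.\<close>
    obtain s where s: "g y < ereal s" "s < t"
      using y by (metis ereal_dense2 less_ereal.simps(1))
    have "\<forall>\<^sub>F k in sequentially. s - t < (y - ph (r k)) \<bullet> vh (r k)"
      using order_tendstoD(1)[OF lim0, of "s - t"] s by simp
    then have "\<forall>\<^sub>F k in sequentially. ph (r k) \<in> {q. g q \<le> ereal t}"
    proof (rule eventually_mono)
      fix k assume k: "s - t < (y - ph (r k)) \<bullet> vh (r k)"
      have "ereal (\<gamma> (r k) + (y - ph (r k)) \<bullet> vh (r k)) < ereal s"
        using subgradient[of "r k" y] s(1) by (rule order_le_less_trans)
      then show "ph (r k) \<in> {q. g q \<le> ereal t}" using k by (simp add: attained)
    qed
    then have "q \<in> {q. g q \<le> ereal t}"
      by (rule Lim_in_closed_set[OF closed_sublevel _ _ phr]) simp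
    then show ?thesis by simp
  qed
  have "g q \<le> g y" for y
  proof (rule ccontr)
    assume "\<not> g q \<le> g y"
    then obtain t where "g y < ereal t" "ereal t < g q"
      using ereal_dense2[of "g y" "g q"] by (meson not_le)
    then show False using le[of y t] by simp
  qed
  moreover have "g q < \<infinity>"
    using le[of "ph 0" "\<gamma> 0 + 1"] by (auto simp: attained)
  ultimately show ?thesis by (simp add: is_minimizer_def)
qed

text \<open>Fejer estimates around a given minimizer bound \<open>p\<close>, so it has a cluster
  point, itself a minimizer. Reapplying the estimate around that cluster point gives convergent
  distances with a subsequence tending to 0, hence full convergence.\<close>

theorem converges:
  assumes "is_minimizer g q"
  shows "(\<exists>q. is_minimizer g q \<and> p \<longlonglongrightarrow> q)" and "(\<lambda>k. c k *\<^sub>R vh k) \<longlonglongrightarrow> 0"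
proof -
  have minim: "g q' \<le> g (ph k)" if "is_minimizer g q'" for q' k
    using that by (simp add: is_minimizer_def)
  show vh: "(\<lambda>k. c k *\<^sub>R vh k) \<longlonglongrightarrow> 0"
    using quasi_Fejer(2)[OF minim[OF assms]] .
  have "Bseq (\<lambda>k. dnorm (p k - q))"
    using quasi_Fejer(1)[OF minim[OF assms]] by (rule convergent_imp_Bseq)
  then obtain K where K: "\<And>k. \<bar>dnorm (p k - q)\<bar> \<le> K" by (auto simp: Bseq_def)
  have "dnorm (p k) \<le> K + dnorm q" for k
    using wnorm_triangle[OF inverse_spd, of "p k - q" q] K[of k] by (simp add: dnorm_def)
  then have "bounded (range p)"
    using bounded_range_wnorm_iff[OF inverse_spd, of p] by (auto simp: dnorm_def)
  then obtain q' r where r: "strict_mono r" and pr: "(p \<circ> r) \<longlonglongrightarrow> q'"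
    using bounded_imp_convergent_subsequence[of p] by auto
  have q': "is_minimizer g q'" by (rule cluster_point_minimizes[OF vh r pr])
  obtain l where l: "(\<lambda>k. dnorm (p k - q')) \<longlonglongrightarrow> l"
    using quasi_Fejer(1)[OF minim[OF q']] by (auto simp: convergent_def)
  have "(\<lambda>k. p (r k) - q') \<longlonglongrightarrow> 0"
    using pr by (simp add: o_def LIM_zero)
  then have "(\<lambda>k. dnorm (p (r k) - q')) \<longlonglongrightarrow> 0"
    by (simp add: dnorm_def tendsto_zero_wnorm_iff[OF inverse_spd])
  then have "l = 0"
    using LIMSEQ_subseq_LIMSEQ[OF l r] LIMSEQ_unique by (fastforce simp: o_def)
  then have "(\<lambda>k. p k - q') \<longlonglongrightarrow> 0"
    using l by (simp add: dnorm_def tendsto_zero_wnorm_iff[OF inverse_spd])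
  then have "p \<longlonglongrightarrow> q'" by (rule LIM_zero_cancel)
  with q' show "\<exists>q. is_minimizer g q \<and> p \<longlonglongrightarrow> q" by blast
qed

text \<open>If \<open>p\<close> is bounded, so are the exact proximal points, and a point of the compact closure of
  their range minimizing \<open>g\<close> there can replace the minimizer of \<open>g\<close> in the Fejer argument.\<close>

theorem bounded_imp_minimizer:
  assumes "bounded (range p)"
  shows "\<exists>q. is_minimizer g q"
proof -
  obtain B where B: "\<And>k. dnorm (p k) \<le> B"
    using iffD1[OF bounded_range_wnorm_iff[OF inverse_spd] assms] unfolding dnorm_def by blast
  obtain E where E: "\<And>k. \<bar>\<eta> k\<bar> \<le> E"
    using convergent_imp_Bseq[OF convergentI[OF summable_LIMSEQ_zero[OF summable_error]]]
    unfolding Bseq_def real_norm_def by blast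
  have "dnorm (ph k) \<le> B + (2 * B / \<nu>min + E)" for k
  proof -
    \<comment> \<open>The scaled approximate subgradient is recovered from the difference of
      consecutive iterates; the lower bound on the relaxation makes this uniform.\<close>
    have "\<nu> k * wnorm W (c k *\<^sub>R v k) = dnorm (p k - p (Suc k))"
      using \<nu>_pos[of k] c_pos[of k] wnorm_matrix_inv_mult[OF W, of "(\<nu> k * c k) *\<^sub>R v k"]
      by (simp add: step dnorm_def wnorm_scaleR matrix_vector_mult_scaleR mult.assoc)
    also have "\<dots> \<le> 2 * B"
      using wnorm_triangle[OF inverse_spd, of "p k" "- p (Suc k)"] B[of k] B[of "Suc k"]
      by (simp add: dnorm_def wnorm_minus)
    finally have "\<nu>min * wnorm W (c k *\<^sub>R v k) \<le> 2 * B"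
      using mult_right_mono[OF \<nu>min(2)[of k] wnorm_nonneg[OF W, of "c k *\<^sub>R v k"]] by linarith
    then have 1: "wnorm W (c k *\<^sub>R v k) \<le> 2 * B / \<nu>min"
      using \<nu>min(1) by (simp add: pos_le_divide_eq mult.commute)
    have "wnorm W (c k *\<^sub>R vh k) \<le> wnorm W (c k *\<^sub>R v k) + wnorm W (- (c k *\<^sub>R (v k - vh k)))"
      using wnorm_triangle[OF W, of "c k *\<^sub>R v k" "- (c k *\<^sub>R (v k - vh k))"]
      by (simp add: scaleR_diff_right)
    moreover have "wnorm W (- (c k *\<^sub>R (v k - vh k))) \<le> E"
      using error[of k] E[of k] c_pos[of k] by (simp add: wnorm_minus wnorm_scaleR)
    moreover have "dnorm (ph k) \<le> dnorm (p k) + wnorm W (c k *\<^sub>R vh k)"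
      using wnorm_triangle[OF inverse_spd, of "p k" "- (W *v (c k *\<^sub>R vh k))"]
      by (simp only: ph dnorm_def wnorm_minus wnorm_matrix_inv_mult[OF W])
        (simp add: matrix_vector_mult_scaleR)
    ultimately show ?thesis using 1 B[of k] by linarith
  qed
  then have "bounded (range ph)"
    using bounded_range_wnorm_iff[OF inverse_spd, of ph] by (auto simp: dnorm_def)
  then have compact: "compact (closure (range ph))" by simp
  have inS: "ph k \<in> closure (range ph)" for k
    by (rule subsetD[OF closure_subset]) simp
  \<comment> \<open>Finite intersection property: among finitely many indices, the proximal point
    with least \<open>\<gamma>\<close> lies in all the sublevel sets. A common point of all of them
    serves as \<open>q\<close>.\<close>
  have "closure (range ph) \<inter> (\<Inter>k. {q. g q \<le> ereal (\<gamma> k)}) \<noteq> {}"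
  proof (rule compact_imp_fip_image[OF compact])
    fix I :: "nat set" assume I: "finite I" "I \<subseteq> UNIV"
    show "closure (range ph) \<inter> (\<Inter>k\<in>I. {q. g q \<le> ereal (\<gamma> k)}) \<noteq> {}"
    proof (cases "I = {}")
      case True
      then show ?thesis using inS by auto
    next
      case False
      then have "Min (\<gamma> ` I) \<in> \<gamma> ` I"
        using I by (intro Min_in) auto
      then obtain j where j: "j \<in> I" "Min (\<gamma> ` I) = \<gamma> j" by blast
      have "\<gamma> j \<le> \<gamma> k" if "k \<in> I" for k
        using I that unfolding j(2)[symmetric] by (intro Min_le) auto
      then have "ph j \<in> closure (range ph) \<inter> (\<Inter>k\<in>I. {q. g q \<le> ereal (\<gamma> k)})"
        using inS by (auto simp: attained)
      then show ?thesis by blast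
    qed
  qed (rule closed_sublevel)
  then obtain q where q: "\<And>k. g q \<le> g (ph k)" by (auto simp: attained)
  have vh: "(\<lambda>k. c k *\<^sub>R vh k) \<longlonglongrightarrow> 0" by (rule quasi_Fejer(2)[OF q])
  obtain q' r where "strict_mono r" "(p \<circ> r) \<longlonglongrightarrow> q'"
    using bounded_imp_convergent_subsequence[OF assms] by auto
  then show ?thesis using cluster_point_minimizes[OF vh] by blast
qed

end

section \<open>Augmented Lagrangian minimization as a dual proximal step\<close>

text \<open>Both the supremum and the inner infimum unfold into one family of affine inequalities. A
  real bound on the dual value is thus an affine minorant of \<open>F\<close> with zero slope in
  \<open>x\<close>.\<close>

lemma conjugate_value_fun_le_iff:
  fixes F :: "'a \<times> 'b::real_inner \<Rightarrow> ereal"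
  shows "conjugate (value_fun F) q \<le> ereal t \<longleftrightarrow> (\<forall>x u. ereal (u \<bullet> q - t) \<le> F (x, u))"
proof -
  have "ereal a - s \<le> ereal t \<longleftrightarrow> ereal (a - t) \<le> s" for a s
    by (cases s) auto
  then show ?thesis
    by (auto simp: conjugate_def value_fun_def SUP_le_iff le_INF_iff)
qed

lemma closed_conjugate_value_fun_sublevel:
  fixes F :: "'a \<times> 'b::real_inner \<Rightarrow> ereal"
  shows "closed {q. conjugate (value_fun F) q \<le> ereal t}"
proof -
  have "closed {q. ereal (u \<bullet> q - t) \<le> s}" for u :: 'b and s
    by (cases s) (auto intro!: closed_Collect_le continuous_intros)
  then show ?thesis
    unfolding conjugate_value_fun_le_iff by (intro closed_Collect_all)
qed

section \<open>Convexity and first-order optimality\<close>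

lemma ereal_convexD:
  assumes "ereal_convex f" "f a \<le> ereal \<alpha>" "f b \<le> ereal \<beta>" "0 \<le> t" "t \<le> 1"
  shows "f ((1 - t) *\<^sub>R a + t *\<^sub>R b) \<le> ereal ((1 - t) * \<alpha> + t * \<beta>)"
  using convexD[of "{(z, t). f z \<le> ereal t}" "(a, \<alpha>)" "(b, \<beta>)" "1 - t" t] assms
  by (auto simp: ereal_convex_def)

lemma nonneg_if_perturbation_nonneg:
  fixes A B :: real
  assumes "\<And>t. 0 < t \<Longrightarrow> t \<le> 1 \<Longrightarrow> 0 \<le> t * A + t\<^sup>2 * B"
  shows "0 \<le> A"
proof (rule tendsto_lowerbound)
  show "((\<lambda>t. A + t * B) \<longlongrightarrow> A) (at_right 0)"
    by (auto intro!: tendsto_eq_intros)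
  have "\<forall>\<^sub>F t in at_right (0::real). t \<in> {0<..<1}"
    by (rule eventually_at_right_real) simp
  then show "\<forall>\<^sub>F t in at_right 0. 0 \<le> A + t * B"
  proof (rule eventually_mono)
    fix t :: real assume t: "t \<in> {0<..<1}"
    then have "0 \<le> t * (A + t * B)"
      using assms[of t] by (simp add: power2_eq_square algebra_simps)
    then show "0 \<le> A + t * B" using t by (simp add: zero_le_mult_iff)
  qed
qed simp

text \<open>The minimizer is compared with points on the segment to \<open>(x, u)\<close>. Convexity
  of \<open>F\<close> and expansion of the penalty give a polynomial in \<open>t\<close> with linear
  and quadratic terms; its linear coefficient must be nonnegative.\<close>

lemma aug_lagrangian_minimizer_subgradient:
  fixes W :: "real^'m^'m"
  assumes conv: "ereal_convex F" and W: "sym_pos_def W"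
    and minim: "is_minimizer (aug_lagrangian F W c p) (xh, uh)"
    and a: "F (xh, uh) = ereal a"
  shows "ereal (a + (u - uh) \<bullet> (p - c *\<^sub>R (W *v uh))) \<le> F (x, u)"
proof (cases "F (x, u)")
  case (real b)
  let ?d = "u - uh"
  have "0 \<le> t * (b - a - ?d \<bullet> (p - c *\<^sub>R (W *v uh))) + t\<^sup>2 * (c / 2 * (wnorm W ?d)\<^sup>2)"
    if t: "0 < t" "t \<le> 1" for t
  proof -
    have eq: "(1 - t) *\<^sub>R (xh, uh) + t *\<^sub>R (x, u) = (xh + t *\<^sub>R (x - xh), uh + t *\<^sub>R ?d)"
      by (simp add: algebra_simps)
    have le: "F (xh + t *\<^sub>R (x - xh), uh + t *\<^sub>R ?d) \<le> ereal ((1 - t) * a + t * b)"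
      using ereal_convexD[OF conv, of "(xh, uh)" a "(x, u)" b t] a real t unfolding eq by simp
    have "aug_lagrangian F W c p (xh, uh)
        \<le> aug_lagrangian F W c p (xh + t *\<^sub>R (x - xh), uh + t *\<^sub>R ?d)"
      using minim by (simp add: is_minimizer_def)
    also have "\<dots> \<le> ereal ((1 - t) * a + t * b) - ereal (p \<bullet> (uh + t *\<^sub>R ?d))
        + ereal (c / 2 * (wnorm W (uh + t *\<^sub>R ?d))\<^sup>2)"
      unfolding aug_lagrangian_def prod.case by (intro add_mono ereal_minus_mono le order_refl)
    finally have "a - p \<bullet> uh + c / 2 * (wnorm W uh)\<^sup>2 \<le> (1 - t) * a + t * b
        - p \<bullet> (uh + t *\<^sub>R ?d) + c / 2 * (wnorm W (uh + t *\<^sub>R ?d))\<^sup>2"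
      by (simp add: aug_lagrangian_def a)
    moreover have "(wnorm W (uh + t *\<^sub>R ?d))\<^sup>2
        = (wnorm W uh)\<^sup>2 + 2 * t * (?d \<bullet> (W *v uh)) + t\<^sup>2 * (wnorm W ?d)\<^sup>2"
      using inner_matrix_commute[OF W, of uh ?d]
      by (simp add: wnorm_add_square[OF W] wnorm_scaleR power_mult_distrib inner_commute
          matrix_vector_mult_scaleR)
    moreover have "p \<bullet> (uh + t *\<^sub>R ?d) = p \<bullet> uh + t * (?d \<bullet> p)"
      by (simp only: inner_add_right inner_scaleR_right inner_commute)
    moreover have "?d \<bullet> (p - c *\<^sub>R (W *v uh)) = ?d \<bullet> p - c * (?d \<bullet> (W *v uh))"
      by (simp only: inner_diff_right inner_scaleR_right)
    ultimately show ?thesis by (simp only:) (simp add: algebra_simps)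
  qed
  then have "0 \<le> b - a - ?d \<bullet> (p - c *\<^sub>R (W *v uh))"
    by (rule nonneg_if_perturbation_nonneg)
  then show ?thesis using real by simp
next
  case MInf
  \<comment> \<open>A value \<open>-\<infinity>\<close> at \<open>(x, u)\<close> would contradict
    minimality of the finite value at \<open>(xh, uh)\<close>.\<close>
  then show ?thesis
    using minim a by (auto simp: is_minimizer_def aug_lagrangian_def dest!: spec[of _ x] spec[of _ u])
qed simp

text \<open>Replacing \<open>F\<close> by its affine minorant at the exact minimizer leaves a
  quadratic growth of \<open>c / 2\<close> times the squared W-norm of \<open>u - uh\<close>, which
  \<open>\<delta>\<close> bounds. Multiplying by \<open>2 * c\<close> and taking roots explains the
  form of the bound.\<close>

lemma aug_lagrangian_approx_minimizer_error:
  assumes conv: "ereal_convex F" and W: "sym_pos_def W" and c: "0 < c"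
    and minim: "is_minimizer (aug_lagrangian F W c p) (xh, uh)"
    and a: "F (xh, uh) = ereal a"
    and approx: "(x, u) \<in> delta_argmin \<delta> UNIV (aug_lagrangian F W c p)"
  shows "c * wnorm W (u - uh) \<le> sqrt 2 * sqrt (c * \<delta>)"
proof -
  let ?L = "aug_lagrangian F W c p"
  have "?L (x, u) \<le> (INF y\<in>UNIV. ?L y) + ereal \<delta>"
    using approx by (simp add: delta_argmin_def)
  also have "\<dots> \<le> ?L (xh, uh) + ereal \<delta>"
    by (intro add_right_mono INF_lower) simp
  finally have le: "?L (x, u) \<le> ?L (xh, uh) + ereal \<delta>" .
  have "ereal (a + (u - uh) \<bullet> (p - c *\<^sub>R (W *v uh))) - ereal (p \<bullet> u) + ereal (c / 2 * (wnorm W u)\<^sup>2)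
      \<le> ?L (x, u)"
    unfolding aug_lagrangian_def prod.case
    by (intro add_mono ereal_minus_mono aug_lagrangian_minimizer_subgradient[OF conv W minim a] order_refl)
  also note le
  finally have "a + (u - uh) \<bullet> (p - c *\<^sub>R (W *v uh)) - p \<bullet> u + c / 2 * (wnorm W u)\<^sup>2
      \<le> a - p \<bullet> uh + c / 2 * (wnorm W uh)\<^sup>2 + \<delta>"
    by (simp add: aug_lagrangian_def a)
  moreover have "(wnorm W (u - uh))\<^sup>2 = (wnorm W u)\<^sup>2 - 2 * (u \<bullet> (W *v uh)) + (wnorm W uh)\<^sup>2"
    by (rule wnorm_diff_square[OF W])
  ultimately have "c / 2 * (wnorm W (u - uh))\<^sup>2 \<le> \<delta>"
    using wnorm_square[OF W, of uh]
    by (simp add: inner_diff_left inner_diff_right inner_commute[of p]) (simp add: algebra_simps)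
  then have "2 * c * (c / 2 * (wnorm W (u - uh))\<^sup>2) \<le> 2 * c * \<delta>"
    using c by (intro mult_left_mono) auto
  then have "(c * wnorm W (u - uh))\<^sup>2 \<le> 2 * (c * \<delta>)"
    by (simp add: power2_eq_square algebra_simps)
  then show ?thesis
    using real_le_rsqrt by (fastforce simp: real_sqrt_mult)
qed

lemma lower_semicontinuous_limsup:
  assumes lsc: "lower_semicontinuous F"
    and x: "seq_limit_point x z" and u: "u \<longlonglongrightarrow> w"
  shows "F (z, w) \<le> limsup (\<lambda>k. F (x k, u k))"
proof (rule ccontr)
  assume "\<not> ?thesis"
  then obtain t where t: "limsup (\<lambda>k. F (x k, u k)) < t" "t < F (z, w)"
    using ereal_dense2[of "limsup (\<lambda>k. F (x k, u k))" "F (z, w)"] by (metis not_le)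
  obtain r where r: "strict_mono r" and xr: "(x \<circ> r) \<longlonglongrightarrow> z"
    using x by (auto simp: seq_limit_point_def)
  have "\<forall>\<^sub>F y in at (z, w). t < F y"
    using lsc t(2) by (simp add: lower_semicontinuous_def le_Liminf_iff)
  \<comment> \<open>Semicontinuity is stated with a punctured neighborhood; the center is added back
    because the sequence may hit it.\<close>
  then have "\<forall>\<^sub>F y in nhds (z, w). t < F y"
    using t(2) by (auto simp: eventually_at_filter elim: eventually_mono)
  moreover have "(\<lambda>k. (x (r k), u (r k))) \<longlonglongrightarrow> (z, w)"
    using xr LIMSEQ_subseq_LIMSEQ[OF u r] by (intro tendsto_Pair) (auto simp: o_def)
  ultimately have "\<forall>\<^sub>F k in sequentially. t < F (x (r k), u (r k))"
    by (rule eventually_compose_filterlim)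
  moreover have "\<forall>\<^sub>F k in sequentially. F (x k, u k) < t"
    using t(1) by (rule Limsup_lessD)
  then have "\<forall>\<^sub>F k in sequentially. F (x (r k), u (r k)) < t"
    using eventually_subseq[OF r] by blast
  ultimately have "\<forall>\<^sub>F k in sequentially. False"
    by eventually_elim simp
  then show False by simp
qed

theorem proposition12:
  fixes F :: "(real^'n) \<times> (real^'m) \<Rightarrow> ereal"
    and W :: "real^'m^'m"
    and c \<nu> \<delta> :: "nat \<Rightarrow> real"
    and p u :: "nat \<Rightarrow> real^'m"
    and x :: "nat \<Rightarrow> real^'n"
  assumes F_closed: "lower_semicontinuous F"
    and F_proper: "proper F"
    and F_convex: "ereal_convex F"
    and c_pos: "\<And>k. 0 < c k"
    and c_inf: "0 < (INF k. ereal (c k))"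
    and nu_inf: "0 < (INF k. ereal (\<nu> k))"
    and nu_sup: "(SUP k. ereal (\<nu> k)) < 2"
    and delta_nonneg: "\<And>k. 0 \<le> \<delta> k"
    and delta_summable: "summable (\<lambda>k. sqrt (c k * \<delta> k))"
    and W: "sym_pos_def W"
    and attained: "\<And>k. \<exists>z. is_minimizer (aug_lagrangian F W (c k) (p k)) z"
    and approx_min: "\<And>k. (x (Suc k), u (Suc k))
          \<in> delta_argmin (\<delta> k) UNIV (aug_lagrangian F W (c k) (p k))"
    and p_step: "\<And>k. p (Suc k) = p k - (\<nu> k * c k) *\<^sub>R (W *v u (Suc k))"
  shows "((\<exists>q. is_minimizer (conjugate (value_fun F)) q) \<longrightarrow>
            (\<exists>q. is_minimizer (conjugate (value_fun F)) q \<and> p \<longlonglongrightarrow> q)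
          \<and> (\<lambda>k. c k *\<^sub>R u (Suc k)) \<longlonglongrightarrow> 0
          \<and> u \<longlonglongrightarrow> 0
          \<and> limsup (\<lambda>k. F (x k, u k)) \<le> (INF y. F (y, 0))
          \<and> (\<forall>z. seq_limit_point x z \<longrightarrow> is_minimizer (\<lambda>y. F (y, 0)) z))
       \<and> ((\<nexists>q. is_minimizer (conjugate (value_fun F)) q) \<longrightarrow> \<not> bounded (range p))"
proof -
  let ?g = "conjugate (value_fun F)"
  \<comment> \<open>The strict bounds on the infima and the supremum leave room for real constants
    valid for every \<open>k\<close>.\<close>
  obtain cmin where *: "0 < ereal cmin" "ereal cmin < (INF k. ereal (c k))"
    using ereal_dense2[OF c_inf] by auto
  then have cmin: "0 < cmin" "\<And>k. cmin \<le> c k"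
    using less_INF_D[OF *(2) UNIV_I] by (auto simp: less_imp_le)
  obtain \<nu>min where *: "0 < ereal \<nu>min" "ereal \<nu>min < (INF k. ereal (\<nu> k))"
    using ereal_dense2[OF nu_inf] by auto
  then have \<nu>min: "0 < \<nu>min" "\<And>k. \<nu>min \<le> \<nu> k"
    using less_INF_D[OF *(2) UNIV_I] by (auto simp: less_imp_le)
  obtain \<nu>max where "(SUP k. ereal (\<nu> k)) < ereal \<nu>max" "ereal \<nu>max < 2"
    using ereal_dense2[OF nu_sup] by auto
  then have \<nu>max: "\<nu>max < 2" "\<And>k. \<nu> k \<le> \<nu>max"
    by (auto dest!: SUP_lessD intro: less_imp_le)

  obtain z where z: "\<And>k. is_minimizer (aug_lagrangian F W (c k) (p k)) (z k)"
    using attained by metis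
  define xh uh where "xh k = fst (z k)" and "uh k = snd (z k)" for k
  have minim: "is_minimizer (aug_lagrangian F W (c k) (p k)) (xh k, uh k)" for k
    using z by (simp add: xh_def uh_def)
  have "\<exists>a. F (xh k, uh k) = ereal a" for k
    using minim[of k] F_proper
    by (cases "F (xh k, uh k)") (auto simp: is_minimizer_def aug_lagrangian_def proper_def)
  then obtain a where a: "\<And>k. F (xh k, uh k) = ereal (a k)" by metis
  define ph where "ph k = p k - c k *\<^sub>R (W *v uh k)" for k
  note sub = aug_lagrangian_minimizer_subgradient[OF F_convex W minim a, folded ph_def]

  \<comment> \<open>This is the Fenchel-Young inequality at the exact minimizer. It becomes an
    equality at \<open>ph k\<close>, where \<open>sub\<close> supplies the reverse bound.\<close>
  have dual_ge: "ereal (uh k \<bullet> q - a k) \<le> ?g q" for k q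
  proof (rule ereal_le_real)
    fix t assume "?g q \<le> ereal t"
    then have "ereal (uh k \<bullet> q - t) \<le> F (xh k, uh k)"
      by (simp add: conjugate_value_fun_le_iff)
    then show "ereal (uh k \<bullet> q - a k) \<le> ereal t" by (simp add: a)
  qed
  have dual_value: "?g (ph k) = ereal (uh k \<bullet> ph k - a k)" for k
    using sub by (intro antisym dual_ge)
      (simp add: conjugate_value_fun_le_iff inner_diff_left algebra_simps)

  \<comment> \<open>The index shift matches step \<open>k\<close> with the primal output
    \<open>u (Suc k)\<close>; \<open>uh k\<close> is the exact dual subgradient that it
    approximates.\<close>
  interpret relaxed_proximal_point ?g W c \<nu> "\<lambda>k. sqrt 2 * sqrt (c k * \<delta> k)"
    "\<lambda>k. uh k \<bullet> ph k - a k" p ph "\<lambda>k. u (Suc k)" uh cmin \<nu>min \<nu>max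
  proof
    show "ereal (uh k \<bullet> ph k - a k + (q - ph k) \<bullet> uh k) \<le> ?g q" for k q
      using dual_ge[of k q] by (simp add: inner_diff_right inner_commute[of _ "uh k"])
    show "c k * wnorm W (u (Suc k) - uh k) \<le> sqrt 2 * sqrt (c k * \<delta> k)" for k
      by (rule aug_lagrangian_approx_minimizer_error[OF F_convex W c_pos minim a approx_min])
  qed (use cmin \<nu>min \<nu>max W p_step delta_summable dual_value in
      \<open>auto simp: ph_def summable_mult intro!: closed_conjugate_value_fun_sublevel\<close>)

  have "(\<exists>q. is_minimizer ?g q \<and> p \<longlonglongrightarrow> q)
      \<and> (\<lambda>k. c k *\<^sub>R u (Suc k)) \<longlonglongrightarrow> 0
      \<and> u \<longlonglongrightarrow> 0
      \<and> limsup (\<lambda>k. F (x k, u k)) \<le> (INF y. F (y, 0))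
      \<and> (\<forall>z. seq_limit_point x z \<longrightarrow> is_minimizer (\<lambda>y. F (y, 0)) z)"
    if minimizer: "is_minimizer ?g q" for q
  proof -
    from converges[OF minimizer] obtain q' where q': "is_minimizer ?g q'" "p \<longlonglongrightarrow> q'"
      and cuh: "(\<lambda>k. c k *\<^sub>R uh k) \<longlonglongrightarrow> 0" by blast
    have "(\<lambda>k. c k *\<^sub>R uh k + c k *\<^sub>R (u (Suc k) - uh k)) \<longlonglongrightarrow> 0 + 0"
      by (intro tendsto_add cuh error_tendsto)
    then have cu: "(\<lambda>k. c k *\<^sub>R u (Suc k)) \<longlonglongrightarrow> 0" by (simp add: scaleR_diff_right)
    then have u_Suc: "(\<lambda>k. u (Suc k)) \<longlonglongrightarrow> 0" by (rule tendsto_zero_unscaled)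
    then have u: "u \<longlonglongrightarrow> 0" by (rule LIMSEQ_imp_Suc)
    have uh: "uh \<longlonglongrightarrow> 0" using cuh by (rule tendsto_zero_unscaled)

    \<comment> \<open>Terms of the summable series tend to 0, so their squares
      \<open>c k * \<delta> k\<close> do too; dividing by \<open>cmin\<close> dominates
      \<open>\<delta> k\<close>.\<close>
    have "(\<lambda>k. (sqrt (c k * \<delta> k))\<^sup>2 / cmin) \<longlonglongrightarrow> 0\<^sup>2 / cmin"
      using cmin(1) by (intro tendsto_intros summable_LIMSEQ_zero[OF delta_summable]) auto
    then have cd: "(\<lambda>k. c k * \<delta> k / cmin) \<longlonglongrightarrow> 0"
      using delta_nonneg c_pos by (simp add: less_imp_le)
    have "\<delta> k \<le> c k * \<delta> k / cmin" for k
      using mult_right_mono[OF cmin(2)[of k] delta_nonneg[of k]] cmin(1)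
      by (simp add: pos_le_divide_eq mult.commute)
    then have \<delta>: "\<delta> \<longlonglongrightarrow> 0"
      by (intro tendsto_sandwich[OF _ _ tendsto_const cd]) (auto simp: delta_nonneg)

    \<comment> \<open>This collects the multiplier term moved across the inequality and the
      tolerance; it vanishes because \<open>p\<close> converges and \<open>u\<close> tends to
      0.\<close>
    define \<epsilon> where "\<epsilon> k = p k \<bullet> u (Suc k) + \<delta> k" for k
    have "\<epsilon> \<longlonglongrightarrow> q' \<bullet> 0 + 0"
      unfolding \<epsilon>_def by (intro tendsto_intros q' u_Suc \<delta>)
    then have \<epsilon>: "\<epsilon> \<longlonglongrightarrow> 0" by simp
    \<comment> \<open>Approximate optimality is tested against an arbitrary point, and the
      nonnegative penalty at the iterate is dropped.\<close>
    have upper: "F (x (Suc k), u (Suc k))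
        \<le> F (y, w) - ereal (p k \<bullet> w) + ereal (c k / 2 * (wnorm W w)\<^sup>2) + ereal (\<epsilon> k)" for k y w
    proof -
      have "aug_lagrangian F W (c k) (p k) (x (Suc k), u (Suc k))
          \<le> (INF z\<in>UNIV. aug_lagrangian F W (c k) (p k) z) + ereal (\<delta> k)"
        using approx_min[of k] by (simp add: delta_argmin_def)
      also have "\<dots> \<le> aug_lagrangian F W (c k) (p k) (y, w) + ereal (\<delta> k)"
        by (intro add_right_mono INF_lower) simp
      finally have *: "F (x (Suc k), u (Suc k)) - ereal (p k \<bullet> u (Suc k))
          + ereal (c k / 2 * (wnorm W (u (Suc k)))\<^sup>2)
          \<le> F (y, w) - ereal (p k \<bullet> w) + ereal (c k / 2 * (wnorm W w)\<^sup>2) + ereal (\<delta> k)"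
        by (simp add: aug_lagrangian_def)
      have "0 \<le> c k / 2 * (wnorm W (u (Suc k)))\<^sup>2"
        using c_pos[of k] by simp
      with * show ?thesis
        by (cases "F (x (Suc k), u (Suc k))"; cases "F (y, w)") (auto simp: \<epsilon>_def)
    qed

    have limsup_Suc: "limsup (\<lambda>k. F (x (Suc k), u (Suc k))) = limsup (\<lambda>k. F (x k, u k))"
      using limsup_shift[of "\<lambda>k. F (x k, u k)"] by simp
    \<comment> \<open>At \<open>w = 0\<close> both the multiplier term and the penalty disappear,
      leaving only \<open>\<epsilon> k\<close>.\<close>
    have limsup_le: "limsup (\<lambda>k. F (x k, u k)) \<le> F (y, 0)" for y
    proof -
      have "limsup (\<lambda>k. F (x (Suc k), u (Suc k))) \<le> limsup (\<lambda>k. F (y, 0) + ereal (\<epsilon> k))"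
        using upper[of _ y 0] by (intro Limsup_mono always_eventually) (simp add: wnorm_def)
      also have "\<dots> = F (y, 0)"
      proof (rule lim_imp_Limsup)
        show "(\<lambda>k. F (y, 0) + ereal (\<epsilon> k)) \<longlonglongrightarrow> F (y, 0)"
          using tendsto_add_ereal_general1[of "ereal 0" "\<lambda>_. F (y, 0)" "F (y, 0)" sequentially
            "\<lambda>k. ereal (\<epsilon> k)"] \<epsilon> by simp
      qed simp
      finally show ?thesis by (simp add: limsup_Suc)
    qed

    have limsup_finite: "limsup (\<lambda>k. F (x k, u k)) < \<infinity>"
      \<comment> \<open>The values of \<open>F\<close> at the exact minimizers are bounded above by the dual optimal value
        up to a vanishing error; this excludes that the primal problem is infeasible.\<close>
    proof -
      obtain d where d: "?g q' = ereal d"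
        using q'(1) dual_ge[of 0 q']
        by (cases "?g q'") (auto simp: is_minimizer_def)
      \<comment> \<open>This bounds the right side of \<open>upper\<close> at
        \<open>(xh k, uh k)\<close>. Since \<open>c k\<close> may be unbounded, the penalty is
        written through \<open>c k *\<^sub>R uh k\<close>, which tends to 0.\<close>
      define \<beta> where "\<beta> k = uh k \<bullet> ph k - d - p k \<bullet> uh k + 1 / 2 * (uh k \<bullet> (W *v (c k *\<^sub>R uh k))) + \<epsilon> k"
        for k
      have Wcuh: "(\<lambda>k. W *v (c k *\<^sub>R uh k)) \<longlonglongrightarrow> W *v 0"
        using cuh by (intro continuous_on_tendsto_compose[OF
              matrix_vector_mult_linear_continuous_on[of UNIV W]]) auto
      have "(\<lambda>k. p k - W *v (c k *\<^sub>R uh k)) \<longlonglongrightarrow> q' - W *v 0"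
        by (intro tendsto_intros q' Wcuh)
      then have "ph \<longlonglongrightarrow> q' - W *v 0" by (simp add: ph_def[abs_def] matrix_vector_mult_scaleR)
      then have "\<beta> \<longlonglongrightarrow> 0 \<bullet> (q' - W *v 0) - d - q' \<bullet> 0 + 1 / 2 * (0 \<bullet> (W *v 0)) + 0"
        unfolding \<beta>_def by (intro tendsto_intros uh q' Wcuh \<epsilon>)
      then have \<beta>: "\<beta> \<longlonglongrightarrow> - d" by simp
      have "F (x (Suc k), u (Suc k)) \<le> ereal (\<beta> k)" for k
      proof -
        \<comment> \<open>Dual minimality of \<open>q'\<close> together with the exact dual value at
          \<open>ph k\<close> turns into an upper bound on \<open>a k\<close>.\<close>
        have "?g q' \<le> ?g (ph k)" using q'(1) by (simp add: is_minimizer_def)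
        then have "a k \<le> uh k \<bullet> ph k - d" by (simp add: d dual_value)
        moreover have "c k / 2 * (wnorm W (uh k))\<^sup>2 = 1 / 2 * (uh k \<bullet> (W *v (c k *\<^sub>R uh k)))"
          by (simp add: wnorm_square[OF W] matrix_vector_mult_scaleR)
        ultimately have "a k - p k \<bullet> uh k + c k / 2 * (wnorm W (uh k))\<^sup>2 + \<epsilon> k \<le> \<beta> k"
          unfolding \<beta>_def by linarith
        then have "F (xh k, uh k) - ereal (p k \<bullet> uh k) + ereal (c k / 2 * (wnorm W (uh k))\<^sup>2)
            + ereal (\<epsilon> k) \<le> ereal (\<beta> k)" by (simp add: a)
        with upper[of k "xh k" "uh k"] show ?thesis by (rule order_trans)
      qed
      then have "limsup (\<lambda>k. F (x (Suc k), u (Suc k))) \<le> limsup (\<lambda>k. ereal (\<beta> k))"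
        by (intro Limsup_mono always_eventually) simp
      also have "\<dots> = ereal (- d)"
        using \<beta> by (intro lim_imp_Limsup) auto
      finally show ?thesis
        by (auto simp: limsup_Suc)
    qed

    \<comment> \<open>Semicontinuity puts \<open>F (z, 0)\<close> below the limsup, which lies below
      every primal value; \<open>limsup_finite\<close> supplies feasibility.\<close>
    have "is_minimizer (\<lambda>y. F (y, 0)) z" if "seq_limit_point x z" for z
      using lower_semicontinuous_limsup[OF F_closed that u] limsup_le limsup_finite
      by (auto simp: is_minimizer_def intro: order_trans order_le_less_trans)
    then show ?thesis
      using q' cu u limsup_le by (auto intro: INF_greatest)
  qed
  then show ?thesis using bounded_imp_minimizer by blast
qed

end
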